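(* Let $S$ be a right cancellative $AG^{*}$-groupoid. Then $S$ is transitively commutative, i.e. for all $a,b,c\in S$, if $ab=ba$ and $bc=cb$, then $ac=ca$.
   Context: A groupoid is a set $S$ with a binary operation, written as juxtaposition; no associativity or commutativity is assumed. An AG-groupoid is a groupoid $S$ satisfying the left invertive law $(ab)c=(cb)a$ for all $a,b,c\in S$. An $AG^{*}$-groupoid is an AG-groupoid satisfying $(ab)c=b(ac)$ for all $a,b,c\in S$. $S$ is right cancellative if every element of $S$ is right cancellative, i.e. for all $a,x,y\in S$, $xa=ya$ implies $x=y$. An AG-groupoid $S$ is transitively commutative if for all $a,b,c\in S$, $ab=ba$ and $bc=cb$ imply $ac=ca$. *)

theory Defs
  imports Main
begin

locale groupoid =
  fixes S :: "'a set" and mult :: "'a \<Rightarrow> 'a \<Rightarrow> 'a" (infixl "\<cdot>" 70)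
  assumes closed: "a \<in> S \<Longrightarrow> b \<in> S \<Longrightarrow> a \<cdot> b \<in> S"

locale AG_groupoid = groupoid +
  assumes left_invertive:
    "a \<in> S \<Longrightarrow> b \<in> S \<Longrightarrow> c \<in> S \<Longrightarrow> (a \<cdot> b) \<cdot> c = (c \<cdot> b) \<cdot> a"

locale AG_star_groupoid = AG_groupoid +
  assumes AG_star:
    "a \<in> S \<Longrightarrow> b \<in> S \<Longrightarrow> c \<in> S \<Longrightarrow> (a \<cdot> b) \<cdot> c = b \<cdot> (a \<cdot> c)"

definition right_cancellative_element :: "'a set \<Rightarrow> ('a \<Rightarrow> 'a \<Rightarrow> 'a) \<Rightarrow> 'a \<Rightarrow> bool" where
  "right_cancellative_element S m a \<longleftrightarrow> (\<forall>x\<in>S. \<forall>y\<in>S. m x a = m y a \<longrightarrow> x = y)"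

definition right_cancellative :: "'a set \<Rightarrow> ('a \<Rightarrow> 'a \<Rightarrow> 'a) \<Rightarrow> bool" where
  "right_cancellative S m \<longleftrightarrow> (\<forall>a\<in>S. right_cancellative_element S m a)"

definition transitively_commutative :: "'a set \<Rightarrow> ('a \<Rightarrow> 'a \<Rightarrow> 'a) \<Rightarrow> bool" where
  "transitively_commutative S m \<longleftrightarrow>
    (\<forall>a\<in>S. \<forall>b\<in>S. \<forall>c\<in>S. m a b = m b a \<and> m b c = m c b \<longrightarrow> m a c = m c a)"

end

(* The two laws give b(ac) = (ab)c = (cb)a = b(ca). Multiplying b x = b y by b on the right turns it
   into x(bb) = y(bb), so right cancellation yields ac = ca: S is outright commutative. *)
theory Submission
  imports Defs
begin

text \<open>The AG* law converts right cancellation into left cancellation. Both laws together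
  expand \<open>(a \<cdot> a) \<cdot> c\<close> in two ways with left factor \<open>a\<close>;
  cancelling it makes any two elements commute.\<close>

context AG_star_groupoid
begin

text \<open>The AG* law gives \<open>(b \<cdot> x) \<cdot> b = x \<cdot> (b \<cdot> b)\<close>,
  which moves \<open>x\<close> to the left of the factor to be cancelled.\<close>

lemma right_cancellative_imp_left_cancel:
  assumes "right_cancellative S mult" and S: "b \<in> S" "x \<in> S" "y \<in> S" and "b \<cdot> x = b \<cdot> y"
  shows "x = y"
proof -
  have "x \<cdot> (b \<cdot> b) = y \<cdot> (b \<cdot> b)"
    using AG_star[of b x b] AG_star[of b y b] S \<open>b \<cdot> x = b \<cdot> y\<close> by simp
  then show ?thesis
    using assms(1) S closed[of b b]
    unfolding right_cancellative_def right_cancellative_element_def by blast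
qed

lemma right_cancellative_imp_commute:
  assumes "right_cancellative S mult" and S: "a \<in> S" "c \<in> S"
  shows "a \<cdot> c = c \<cdot> a"
proof -
  \<comment> \<open>Both sides equal
    \<open>(a \<cdot> a) \<cdot> c = (c \<cdot> a) \<cdot> a\<close>; the auxiliary left factor is
    taken to be \<open>a\<close> itself.\<close>
  have "a \<cdot> (a \<cdot> c) = a \<cdot> (c \<cdot> a)"
    using AG_star[of a a c] left_invertive[of a a c] AG_star[of c a a] S by simp
  then show ?thesis
    using right_cancellative_imp_left_cancel assms closed by blast
qed

end

theorem theorem9:
  fixes S :: "'a set" and m :: "'a \<Rightarrow> 'a \<Rightarrow> 'a"
  assumes "AG_star_groupoid S m"
    and "right_cancellative S m"
  shows "transitively_commutative S m"
  using AG_star_groupoid.right_cancellative_imp_commute[OF assms]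
  unfolding transitively_commutative_def by blast

end
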